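(* Let $S_n$ be the saturation level of a random symmetric digital search tree of size $n$, and define $k_S=\lceil \log_2n-\log_2\log n\rceil$. The distribution of $S_n$ is asymptotically concentrated on the two points $k_S-1$ and $k_S$: \[ \mathbb{P}(S_n=k_S-1\text{ or }S_n=k_S)\to1,\qquad(n\to\infty). \]
   Context: Here $\log$ is the natural logarithm and $\log_2$ the logarithm to base $2$. Random symmetric digital search tree (DST) of size $n$: one is given a sequence of $n$ records, each an infinite string of bits, all bits of all records being independent and uniform on $\{0,1\}$. If $n=0$ the tree is a single external node. If $n\ge1$, the first record is stored in the root (an internal node, at level $0$); the remaining $n-1$ records are distributed, retaining their relative order, to the left or right subtree according as their first bit is $0$ or $1$; the subtrees are built recursively by the same rule, using the next bit at each level. Thus the tree is a binary tree with $n$ internal nodes (holding the records) and $n+1$ external nodes (empty places). $I_{n,k}$ is the number of internal nodes at level (distance from the root) $k$. The saturation level is $S_n=\max\{k:I_{n,k}=2^k\}$, i.e. the last level from the root that is completely filled with internal nodes. *)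

theory Defs
  imports "HOL-Probability.Probability" "HOL-Library.Tree"
begin

type_synonym bitstring = "nat \<Rightarrow> bool"

text \<open>
  Bits are Booleans, with 0 rendered as \<^const>\<open>False\<close>. The argument \<open>j\<close> is the
  number of leading bits already used, i.e. the level at which the subtree is rooted.
  The tree constructor \<^const>\<open>Leaf\<close> is an external node.
\<close>

function dst_from :: "nat \<Rightarrow> bitstring list \<Rightarrow> bitstring tree" where
  "dst_from j [] = Leaf"
| "dst_from j (x # xs) =
     Node (dst_from (Suc j) (filter (\<lambda>y. \<not> y j) xs)) x (dst_from (Suc j) (filter (\<lambda>y. y j) xs))"
  by pat_completeness auto
termination
  by (relation "Wellfounded.measure (\<lambda>(j, xs). length xs)") (auto simp: less_Suc_eq_le)

definition dst :: "bitstring list \<Rightarrow> bitstring tree" where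
  "dst xs = dst_from 0 xs"

fun internal_nodes :: "'a tree \<Rightarrow> nat \<Rightarrow> nat" where
  "internal_nodes Leaf k = 0"
| "internal_nodes (Node l x r) 0 = 1"
| "internal_nodes (Node l x r) (Suc k) = internal_nodes l k + internal_nodes r k"

text \<open>
  For the empty tree the set below is empty and the value is unspecified; for every other
  tree the set is finite and contains 0.
\<close>

definition saturation_level :: "'a tree \<Rightarrow> nat" where
  "saturation_level t = Max {k. internal_nodes t k = 2 ^ k}"

lemma internal_nodes_ge_height: "height t \<le> k \<Longrightarrow> internal_nodes t k = 0"
  by (induction t k rule: internal_nodes.induct) auto

lemma finite_saturated_levels: "finite {k. internal_nodes t k = 2 ^ k}"
proof (rule finite_subset)
  show "{k. internal_nodes t k = 2 ^ k} \<subseteq> {..<height t}"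
    using internal_nodes_ge_height[of t] by (force simp: not_less[symmetric])
qed simp

lemma zero_saturated: "t \<noteq> Leaf \<Longrightarrow> 0 \<in> {k. internal_nodes t k = 2 ^ k}"
  by (cases t) auto

lemma size_dst_from: "size (dst_from j xs) = length xs"
proof (induction j xs rule: dst_from.induct)
  case (2 j x xs)
  then show ?case
    using sum_length_filter_compl[of "\<lambda>y. y j" xs] by simp
qed simp

definition random_bitstring :: "bitstring measure" where
  "random_bitstring = (\<Pi>\<^sub>M j\<in>UNIV. measure_pmf (bernoulli_pmf (1/2)))"

definition random_records :: "(nat \<Rightarrow> bitstring) measure" where
  "random_records = (\<Pi>\<^sub>M i\<in>UNIV. random_bitstring)"

definition random_dst :: "nat \<Rightarrow> (nat \<Rightarrow> bitstring) \<Rightarrow> bitstring tree" where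
  "random_dst n \<omega> = dst (map \<omega> [0..<n])"

definition S :: "nat \<Rightarrow> (nat \<Rightarrow> bitstring) \<Rightarrow> nat" where
  "S n \<omega> = saturation_level (random_dst n \<omega>)"

definition k\<^sub>S :: "nat \<Rightarrow> int" where
  "k\<^sub>S n = \<lceil>log 2 (real n) - log 2 (ln (real n))\<rceil>"

lemma prob_space_random_records: "prob_space random_records"
  unfolding random_records_def random_bitstring_def
  by (intro prob_space_PiM prob_space_measure_pmf)

end

theory Submission imports Defs "HOL-Real_Asymp.Real_Asymp"
begin

text \<open>
  Write \<open>k = k\<^sub>S n - 1\<close>, so that \<open>2 ^ k < n / ln n \<le> 2 ^ (k + 1)\<close>. The last full level is
  \<open>k\<close> or \<open>k + 1\<close> as soon as level \<open>k\<close> is full and level \<open>k + 2\<close> is not; both have probability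
  tending to 1, for different reasons.

  Level \<open>k\<close> is full. Fix a word \<open>w\<close> of length \<open>k\<close>. The nodes on the path to \<open>w\<close> are filled from
  the root downwards: while exactly \<open>d\<close> of them are filled, a new record fills the next one if and
  only if its first \<open>d\<close> bits agree with \<open>w\<close>, which has probability \<open>2 ^ -d\<close> independently of the
  past. So the time until the node \<open>w\<close> is filled is a sum of independent geometric variables with
  parameters \<open>2 ^ -d\<close>, \<open>d \<le> k\<close>. The slowest of them dominates, and its tail
  \<open>(1 - 2 ^ -k) ^ n\<close> bounds the tail of the sum up to the factor
  \<open>\<Prod>i\<in>{1..k}. 1 / (1 - 2 ^ -i)\<close>, which is at most 4 (\<open>prob_not_descends_le\<close>,
  \<open>decay_ge\<close>). As \<open>(1 - 2 ^ -k) ^ n \<le> exp (- n / 2 ^ k) \<le> 1 / n\<close>, the union bound over the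
  \<open>2 ^ k\<close> words gives a failure probability of at most \<open>4 / ln n\<close>.

  Level \<open>K = k + 2\<close> is not full. A node can be filled only if some record starts with its word, so
  it suffices that some word of length \<open>K\<close> starts no record. This is a coupon collector problem
  with \<open>2 ^ K \<ge> 2 n / ln n\<close> coupons and \<open>n\<close> draws. The expected number of missing coupons is
  \<open>2 ^ K * (1 - 2 ^ -K) ^ n\<close>, which is at least of order \<open>sqrt n / ln n\<close>. Two coupons are missing
  together with probability \<open>(1 - 2 * 2 ^ -K) ^ n\<close>, at most the square of
  \<open>(1 - 2 ^ -K) ^ n\<close>; hence the variance of the number of missing coupons is at most its mean, and
  the second moment method shows that with high probability the number is not 0
  (\<open>prob_none_le_inverse_expected_count\<close>, \<open>prob_level_full_le\<close>).
\<close>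

section \<open>Nodes addressed by words\<close>

fun filled :: "'a tree \<Rightarrow> bool list \<Rightarrow> bool" where
  "filled Leaf w = False"
| "filled (Node l x r) [] = True"
| "filled (Node l x r) (b # w) = filled (if b then r else l) w"

lemma finite_words: "finite {w :: bool list. length w = k}"
  using finite_lists_length_eq[of "UNIV :: bool set" k] by simp

lemma card_words: "card {w :: bool list. length w = k} = 2 ^ k"
  using card_lists_length_eq[of "UNIV :: bool set" k] by simp

lemma internal_nodes_eq_card: "internal_nodes t k = card {w. length w = k \<and> filled t w}"
proof (induction t k rule: internal_nodes.induct)
  case (2 l x r)
  have "{w. length w = 0 \<and> filled (Node l x r) w} = {[]}" by auto
  then show ?case by simp
next
  case (3 l x r k)
  let ?A = "\<lambda>t. {w. length w = k \<and> filled t w}"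
  have fin: "finite (?A t)" for t :: "'a tree"
    by (rule finite_subset[OF _ finite_words[of k]]) auto
  have "{w. length w = Suc k \<and> filled (Node l x r) w} = (#) False ` ?A l \<union> (#) True ` ?A r"
    by (auto simp: length_Suc_conv split: if_splits)
  moreover have "card ((#) False ` ?A l \<union> (#) True ` ?A r) = card (?A l) + card (?A r)"
    by (subst card_Un_disjoint) (auto simp: fin card_image)
  ultimately show ?case using 3 by simp
qed simp

lemma saturated_iff: "internal_nodes t k = 2 ^ k \<longleftrightarrow> (\<forall>w. length w = k \<longrightarrow> filled t w)"
proof -
  have "internal_nodes t k = 2 ^ k \<longleftrightarrow> card {w. length w = k \<and> filled t w} = card {w :: bool list. length w = k}"
    by (simp add: internal_nodes_eq_card card_words)
  also have "\<dots> \<longleftrightarrow> {w. length w = k \<and> filled t w} = {w. length w = k}"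
    using card_subset_eq[OF finite_words[of k], of "{w. length w = k \<and> filled t w}"] by auto
  finally show ?thesis by auto
qed

lemma filled_append: "filled t (u @ v) \<Longrightarrow> filled t u"
  by (induction t u rule: filled.induct) auto

text \<open>
  The filled positions are closed under prefixes, so a full level forces every level
  nearer to the root to be full. This is what makes the saturation level a matter of two consecutive levels only.
\<close>

lemma saturated_mono:
  assumes "internal_nodes t k = 2 ^ k" "j \<le> k"
  shows "internal_nodes t j = 2 ^ j"
  unfolding saturated_iff
proof (intro allI impI)
  fix w :: "bool list" assume "length w = j"
  with assms have "filled t (w @ replicate (k - j) False)" by (auto simp: saturated_iff)
  then show "filled t w" by (rule filled_append)
qed

lemma saturation_level_eq_iff:
  assumes "t \<noteq> Leaf"
  shows "saturation_level t = s \<longleftrightarrow> internal_nodes t s = 2 ^ s \<and> internal_nodes t (Suc s) \<noteq> 2 ^ Suc s"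
proof -
  have ne: "{k. internal_nodes t k = 2 ^ k} \<noteq> {}" using zero_saturated[OF assms] by blast
  have "saturation_level t = s \<longleftrightarrow> internal_nodes t s = 2 ^ s \<and> (\<forall>k. internal_nodes t k = 2 ^ k \<longrightarrow> k \<le> s)"
    unfolding saturation_level_def using Max_eq_iff[OF finite_saturated_levels ne] by auto
  also have "(\<forall>k. internal_nodes t k = 2 ^ k \<longrightarrow> k \<le> s) \<longleftrightarrow> internal_nodes t (Suc s) \<noteq> 2 ^ Suc s"
    using saturated_mono[of t _ "Suc s"] by (metis not_less_eq_eq order_refl)
  finally show ?thesis .
qed

section \<open>Filling the path to one word\<close>

definition agree :: "bool list \<Rightarrow> nat \<Rightarrow> bitstring \<Rightarrow> bool" where
  "agree w d x \<longleftrightarrow> (\<forall>j<d. x j = w ! j)"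

text \<open>
  The history of the path to the word \<open>w\<close>, seen from the moment at which its first \<open>d\<close> nodes are
  filled: the truth value says whether the remaining records fill the node \<open>w\<close> itself, which is
  the node number \<open>length w\<close> on the path, the root having number 0.
\<close>

fun descends :: "bool list \<Rightarrow> nat \<Rightarrow> bitstring list \<Rightarrow> bool" where
  "descends w d [] = False"
| "descends w d (x # xs) =
     (if agree w d x then d = length w \<or> descends w (Suc d) xs else descends w d xs)"

text \<open>
  The subtree below the first \<open>d\<close> letters of \<open>w\<close> receives exactly the records that agree with these
  letters. Keeping the filter explicit lets \<open>d\<close> grow along with the path, and turns the recursion of
  the tree over subtrees into one over the sequence of records.
\<close>

lemma filled_dst_from_iff_descends:
  assumes "d \<le> length w"
  shows "filled (dst_from d (filter (agree w d) xs)) (drop d w) \<longleftrightarrow> descends w d xs"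
  using assms
proof (induction xs arbitrary: d)
  case (Cons x xs)
  show ?case
  proof (cases "agree w d x \<and> d < length w")
    case True
    then have drop: "drop d w = w ! d # drop (Suc d) w" by (simp add: Cons_nth_drop_Suc)
    have "agree w (Suc d) = (\<lambda>y. agree w d y \<and> y d = w ! d)"
      by (auto simp: agree_def fun_eq_iff less_Suc_eq)
    then have "filter (agree w (Suc d)) xs = filter (\<lambda>y. y d = w ! d) (filter (agree w d) xs)"
      by (simp add: conj_commute)
    then show ?thesis using True Cons.IH[of "Suc d"] unfolding drop
      by (cases "w ! d") auto
  qed (use Cons in auto)
qed simp

lemma filled_dst_iff_descends: "filled (dst xs) w \<longleftrightarrow> descends w 0 xs"
proof -
  have "agree w 0 = (\<lambda>_. True)" by (simp add: agree_def fun_eq_iff)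
  then show ?thesis using filled_dst_from_iff_descends[of 0 w xs] by (simp add: dst_def)
qed

lemma descends_imp_agree:
  "d \<le> length w \<Longrightarrow> descends w d xs \<Longrightarrow> \<exists>x\<in>set xs. agree w (length w) x"
proof (induction xs arbitrary: d)
  case (Cons x xs)
  show ?case
  proof (cases "agree w d x \<and> d = length w")
    case False
    then have "descends w (if agree w d x then Suc d else d) xs"
      using Cons.prems(2) by (auto split: if_splits)
    moreover have "(if agree w d x then Suc d else d) \<le> length w"
      using False Cons.prems(1) by auto
    ultimately show ?thesis using Cons.IH by (meson list.set_intros(2))
  qed auto
qed simp

section \<open>Cylinder probabilities\<close>

lemma prob_first_coordinates:
  fixes M :: "nat \<Rightarrow> 'a measure"
  assumes "\<And>i. prob_space (M i)" "\<And>i. X i \<in> sets (M i)"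
  shows "measure (Pi\<^sub>M UNIV M) {x \<in> space (Pi\<^sub>M UNIV M). \<forall>j<n. x j \<in> X j} = (\<Prod>j<n. measure (M j) (X j))"
proof -
  interpret product_prob_space M UNIV
    using assms(1) by (simp add: product_prob_space_def product_prob_space_axioms_def product_sigma_finite_def
        prob_space_imp_sigma_finite)
  have "{x \<in> space (Pi\<^sub>M UNIV M). \<forall>j<n. x j \<in> X j} = prod_emb UNIV M {..<n} (Pi\<^sub>E {..<n} X)"
    by (auto simp: prod_emb_def space_PiM PiE_def restrict_def Pi_iff extensional_def)
  then show ?thesis
    using measure_PiM_emb[of "{..<n}" X] assms(2) by simp
qed

lemma prob_space_random_bitstring: "prob_space random_bitstring"
  unfolding random_bitstring_def by (intro prob_space_PiM prob_space_measure_pmf)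

interpretation bits: prob_space random_bitstring by (rule prob_space_random_bitstring)
interpretation records: prob_space random_records by (rule prob_space_random_records)

lemma space_random_bitstring [simp]: "space random_bitstring = UNIV"
  by (simp add: random_bitstring_def space_PiM)

lemma space_random_records [simp]: "space random_records = UNIV"
  by (simp add: random_records_def space_PiM)

lemma sets_bitstring_Collect: "Measurable.pred random_bitstring P \<Longrightarrow> {x. P x} \<in> sets random_bitstring"
  by (drule predE) simp

lemma sets_records_Collect: "Measurable.pred random_records P \<Longrightarrow> {\<omega>. P \<omega>} \<in> sets random_records"
  by (drule predE) simp

lemma measurable_agree [measurable]: "Measurable.pred random_bitstring (agree w d)"
  unfolding agree_def random_bitstring_def by measurable

lemma prob_agree: "bits.prob {x. agree w d x} = (1/2) ^ d"
proof -
  have "measure_pmf.prob (bernoulli_pmf (1/2)) {b} = 1/2" for b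
    by (cases b) (auto simp: measure_pmf_single)
  then have "(\<Prod>j<d. measure_pmf.prob (bernoulli_pmf (1/2)) {w ! j}) = (1/2) ^ d"
    by (subst prod.cong[OF refl, of _ _ "\<lambda>_. 1/2"]) auto
  then show ?thesis
    using prob_first_coordinates[of "\<lambda>_. measure_pmf (bernoulli_pmf (1/2))" "\<lambda>j. {w ! j}" d]
    by (simp add: prob_space_measure_pmf agree_def random_bitstring_def space_PiM)
qed

lemma prob_records_in:
  assumes "A \<in> sets random_bitstring"
  shows "records.prob {\<omega>. \<forall>i<n. \<omega> i \<in> A} = bits.prob A ^ n"
  using prob_first_coordinates[of "\<lambda>_. random_bitstring" "\<lambda>_. A" n] assms
  by (simp add: prob_space_random_bitstring random_records_def[symmetric])

lemma measurable_record [measurable]: "(\<lambda>\<omega>. \<omega> i) \<in> random_records \<rightarrow>\<^sub>M random_bitstring"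
  unfolding random_records_def by measurable

lemma measurable_tail [measurable]: "(\<lambda>\<omega> i. \<omega> (Suc i)) \<in> random_records \<rightarrow>\<^sub>M random_records"
  unfolding random_records_def by (rule measurable_PiM_single') (auto simp: space_PiM)

text \<open>
  Conditioning on the first record: since the records are independent and identically distributed,
  the remaining ones are distributed like the whole sequence.
\<close>

lemma prob_first_record:
  assumes [measurable]: "Measurable.pred random_records P"
  shows "records.prob {\<omega>. P \<omega>} = (\<integral>y. records.prob {\<omega>. P (case_nat y \<omega>)} \<partial>random_bitstring)"
proof -
  interpret seq: sequence_space random_bitstring
    by unfold_locales
  interpret pair: pair_prob_space random_bitstring random_records ..
  have S: "Pi\<^sub>M UNIV (\<lambda>_. random_bitstring) = random_records" by (simp add: random_records_def)
  have [measurable]: "(\<lambda>(s, \<omega>). case_nat s \<omega>) \<in> random_bitstring \<Otimes>\<^sub>M random_records \<rightarrow>\<^sub>M random_records"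
    using measurable_case_nat'[of fst "random_bitstring \<Otimes>\<^sub>M random_records" random_bitstring snd]
    unfolding S by (simp add: split_def)
  have "records.prob {\<omega>. P \<omega>} = measure (distr (random_bitstring \<Otimes>\<^sub>M random_records) random_records (\<lambda>(s, \<omega>). case_nat s \<omega>)) {\<omega>. P \<omega>}"
    using seq.PiM_iter unfolding S by simp
  also have "\<dots> = measure (random_bitstring \<Otimes>\<^sub>M random_records) {z. P (case_nat (fst z) (snd z))}"
    using sets_records_Collect[OF assms]
    by (subst measure_distr) (auto simp: space_pair_measure vimage_def split_def)
  also have "\<dots> = (\<integral>y. records.prob {\<omega>. P (case_nat y \<omega>)} \<partial>random_bitstring)"
  proof -
    let ?f = "indicat_real {z. P (case_nat (fst z) (snd z))}"
    have [measurable]: "Measurable.pred (random_bitstring \<Otimes>\<^sub>M random_records) (\<lambda>z. P (case_nat (fst z) (snd z)))"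
      using measurable_compose[OF \<open>(\<lambda>(s, \<omega>). case_nat s \<omega>) \<in> _\<close> assms] by (simp add: split_def)
    have f: "integrable (random_bitstring \<Otimes>\<^sub>M random_records) ?f"
      by (rule pair.P.integrable_const_bound[of _ 1]) auto
    have "measure (random_bitstring \<Otimes>\<^sub>M random_records) {z. P (case_nat (fst z) (snd z))} = integral\<^sup>L (random_bitstring \<Otimes>\<^sub>M random_records) ?f"
      by (simp add: space_pair_measure)
    also have "\<dots> = (\<integral>y. (\<integral>\<omega>. ?f (y, \<omega>) \<partial>random_records) \<partial>random_bitstring)"
      using pair.integral_fst'[OF f] by simp
    also have "\<dots> = (\<integral>y. records.prob {\<omega>. P (case_nat y \<omega>)} \<partial>random_bitstring)"
    proof -
      have "?f (y, \<omega>) = indicator {\<omega>. P (case_nat y \<omega>)} \<omega>" for y \<omega>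
        by (simp add: indicator_def)
      then show ?thesis by simp
    qed
    finally show ?thesis .
  qed
  finally show ?thesis .
qed


section \<open>The lower tail\<close>

lemma map_upt_Suc_shift: "map \<omega> [0..<Suc n] = \<omega> 0 # map (\<lambda>i. \<omega> (Suc i)) [0..<n]"
  using map_upt_Suc[of \<omega> n] by simp

lemma measurable_descends [measurable]:
  "Measurable.pred random_records (\<lambda>\<omega>. descends w d (map \<omega> [0..<n]))"
proof (induction n arbitrary: d)
  case (Suc n)
  note [measurable] = measurable_compose[OF measurable_tail Suc.IH]
  show ?case unfolding map_upt_Suc_shift by simp
qed simp

text \<open>
  The next record advances the path with probability \<open>2 ^ -d\<close> and leaves it unchanged otherwise.
\<close>

lemma prob_not_descends_Suc:
  "records.prob {\<omega>. \<not> descends w d (map \<omega> [0..<Suc n])} =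
     (1/2) ^ d * (if d = length w then 0 else records.prob {\<omega>. \<not> descends w (Suc d) (map \<omega> [0..<n])}) +
     (1 - (1/2) ^ d) * records.prob {\<omega>. \<not> descends w d (map \<omega> [0..<n])}"
    (is "_ = _ * ?p + _ * ?q")
proof -
  let ?A = "{y. agree w d y}"
  have [measurable]: "?A \<in> sets random_bitstring" 
    by (rule sets_bitstring_Collect) measurable
  have "records.prob {\<omega>. \<not> descends w d (map \<omega> [0..<Suc n])} =
     (\<integral>y. records.prob {\<omega>. \<not> descends w d (map (case_nat y \<omega>) [0..<Suc n])} \<partial>random_bitstring)"
    by (rule prob_first_record) measurable
  also have "\<dots> = (\<integral>y. ?p * indicator ?A y + ?q * (1 - indicator ?A y) \<partial>random_bitstring)"
    by (intro Bochner_Integration.integral_cong refl) (auto simp: map_upt_Suc_shift indicator_def simp del: upt_Suc)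
  also have "\<dots> = ?p * bits.prob ?A + ?q * (1 - bits.prob ?A)"
    by (simp add: bits.prob_space[simplified] less_top[symmetric] )
  finally show ?thesis by (simp add: prob_agree mult.commute)
qed

text \<open>
  The finite products \<open>(1 - 1/2) * (1 - 1/4) * \<dots> * (1 - 2 ^ -r)\<close>, which decrease to a positive
  limit.
\<close>

definition decay :: "nat \<Rightarrow> real" where
  "decay r = (\<Prod>i<r. 1 - (1/2) ^ Suc i)"

text \<open>
  The summand \<open>(1/2) ^ Suc r\<close> strengthens the bound \<open>1/4\<close> enough for induction: with
  \<open>x = (1/2) ^ Suc r\<close>, the step needs \<open>(1/4 + x) * (1 - x) \<ge> 1/4 + x/2\<close>, that is \<open>x \<le> 1/4\<close>.
  This holds for positive \<open>r\<close>; the step from 0 to 1 is an equality at \<open>1/2\<close> on both sides.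
\<close>

lemma decay_ge: "1/4 + (1/2) ^ Suc r \<le> decay r"
proof (induction r)
  case (Suc r)
  define x :: real where "x = (1/2) ^ Suc r"
  show ?case
  proof (cases r)
    case (Suc r')
    have x: "0 \<le> x" "x \<le> 1/4"
      using power_decreasing[of 2 "Suc r" "1/2::real"] Suc by (auto simp: x_def power2_eq_square)
    have "1/4 + x / 2 \<le> (1/4 + x) * (1 - x)"
      using mult_left_mono[OF x(2) x(1)] by (simp add: field_simps)
    also have "\<dots> \<le> decay r * (1 - x)"
      using Suc.IH x by (intro mult_right_mono) (auto simp: x_def)
    finally show ?thesis by (simp add: decay_def x_def)
  qed (simp add: decay_def)
qed (simp add: decay_def)

lemma decay_pos: "decay r > 0"
  using decay_ge[of r] by (rule less_le_trans[rotated]) (auto intro: add_pos_pos)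

text \<open>
  With \<open>k = length w\<close>, the bound on the right solves the recurrence of \<open>prob_not_descends_Suc\<close>
  exactly. Multiplying by \<open>1 - 2 ^ -k\<close> at each time step requires coefficients with
  \<open>c d * (2 ^ -d - 2 ^ -k) = 2 ^ -d * c (d + 1)\<close>, that is
  \<open>c d = c (d + 1) / (1 - 2 ^ -(k - d))\<close>, and \<open>c k = 1\<close> fits the last step, after which the node is
  filled. Only the initial value, where the probability is 1 and all \<open>c d \<ge> 1\<close>, makes it an
  inequality.
\<close>

lemma prob_not_descends_le:
  assumes "d \<le> length w"
  shows "records.prob {\<omega>. \<not> descends w d (map \<omega> [0..<n])} \<le> (1 - (1/2) ^ length w) ^ n / decay (length w - d)"
  using assms
proof (induction n arbitrary: d)
  case 0
  have "decay r \<le> 1" for r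
    unfolding decay_def by (intro prod_le_1) (auto simp: power_le_one simp del: power_Suc)
  then show ?case using decay_pos records.prob_space by (simp add: field_simps)
next
  case (Suc n)
  let ?k = "length w"
  let ?c = "\<lambda>d. 1 / decay (?k - d)" and ?\<rho> = "1 - (1/2) ^ ?k :: real"
  show ?case
  proof (cases "d = ?k")
    case True
    then show ?thesis using Suc.IH[of ?k]
      by (simp add: prob_not_descends_Suc decay_def mult_left_mono power_le_one del: upt_Suc)
  next
    case False
    then have d: "d < ?k" using Suc.prems by simp
    then have "?k - d = Suc (?k - Suc d)" by simp
    then have "decay (?k - d) = decay (?k - Suc d) * (1 - (1/2) ^ (?k - d))"
      unfolding decay_def by (simp only: prod.lessThan_Suc)
    then have c: "?c (Suc d) = ?c d * (1 - (1/2) ^ (?k - d))"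
      using decay_pos[of "?k - Suc d"] decay_pos[of "?k - d"] by (auto simp: field_simps)
    have "records.prob {\<omega>. \<not> descends w d (map \<omega> [0..<Suc n])} \<le>
        (1/2) ^ d * (?\<rho> ^ n * ?c (Suc d)) + (1 - (1/2) ^ d) * (?\<rho> ^ n * ?c d)"
    proof -
      have "records.prob {\<omega>. \<not> descends w (Suc d) (map \<omega> [0..<n])} \<le> ?\<rho> ^ n * ?c (Suc d)"
        "records.prob {\<omega>. \<not> descends w d (map \<omega> [0..<n])} \<le> ?\<rho> ^ n * ?c d"
        using d Suc.IH[of "Suc d"] Suc.IH[of d] by simp_all
      then show ?thesis
        unfolding prob_not_descends_Suc if_not_P[OF False]
        by (intro add_mono mult_left_mono) (auto simp: power_le_one)
    qed
    also have "\<dots> = ?\<rho> ^ n * ?c d * (1 - (1/2) ^ d * (1/2) ^ (?k - d))"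
    proof -
      have "p * (r * (c * (1 - q))) + (1 - p) * (r * c) = r * c * (1 - p * q)" for p q r c :: real
        by (simp add: algebra_simps)
      then show ?thesis unfolding c .
    qed
    also have "(1/2::real) ^ d * (1/2) ^ (?k - d) = (1/2) ^ ?k"
      using d by (simp flip: power_add)
    finally show ?thesis by (simp add: mult_ac)
  qed
qed

definition level_full :: "nat \<Rightarrow> nat \<Rightarrow> (nat \<Rightarrow> bitstring) \<Rightarrow> bool" where
  "level_full n k \<omega> \<longleftrightarrow> internal_nodes (random_dst n \<omega>) k = 2 ^ k"

lemma level_full_iff: "level_full n k \<omega> \<longleftrightarrow> (\<forall>w\<in>{w. length w = k}. descends w 0 (map \<omega> [0..<n]))"
  by (simp add: level_full_def saturated_iff random_dst_def filled_dst_iff_descends)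

lemma measurable_level_full [measurable]: "Measurable.pred random_records (level_full n k)"
  unfolding level_full_iff[abs_def] using finite_words[of k] by measurable

lemma prob_not_level_full_le:
  "records.prob {\<omega>. \<not> level_full n k \<omega>} \<le> 4 * 2 ^ k * (1 - 1 / 2 ^ k) ^ n"
proof -
  let ?W = "{w :: bool list. length w = k}" and ?E = "\<lambda>w. {\<omega>. \<not> descends w 0 (map \<omega> [0..<n])}"
  have E: "?E w \<in> records.events" for w
    by (rule sets_records_Collect) measurable
  have d: "1 / decay k \<le> 4"
    using decay_ge[of k] zero_le_power[of "1/2::real" "Suc k"] by (simp add: divide_le_eq del: zero_le_power)
  have "records.prob {\<omega>. \<not> level_full n k \<omega>} = records.prob (\<Union>w\<in>?W. ?E w)"
    by (rule arg_cong[where f = records.prob]) (auto simp: level_full_iff)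
  also have "\<dots> \<le> (\<Sum>w\<in>?W. records.prob (?E w))"
    using finite_words E by (intro measure_UNION_le) auto
  also have "\<dots> \<le> (\<Sum>w\<in>?W. 4 * (1 - 1 / 2 ^ k) ^ n)"
  proof (rule sum_mono)
    fix w assume "w \<in> ?W"
    then have "records.prob (?E w) \<le> (1 - 1 / 2 ^ k) ^ n * (1 / decay k)"
      using prob_not_descends_le[of 0 w n] by (simp add: power_one_over)
    also have "\<dots> \<le> (1 - 1 / 2 ^ k) ^ n * 4" by (intro mult_left_mono d) auto
    finally show "records.prob (?E w) \<le> 4 * (1 - 1 / 2 ^ k) ^ n" by simp
  qed
  finally show ?thesis by (simp add: card_words)
qed

section \<open>The upper tail\<close>

text \<open>
  The second moment method. Let \<open>N\<close> be the number of events that occur and \<open>\<mu>\<close> its mean. Pairwise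
  negative correlation gives \<open>E (N\<^sup>2) \<le> \<mu> + \<mu>\<^sup>2\<close>, so the variance is at most \<open>\<mu>\<close>, while on the event
  \<open>N = 0\<close> the squared deviation from the mean is \<open>\<mu>\<^sup>2\<close>. The product form of the conclusion covers
  \<open>\<mu> = 0\<close>.
\<close>

lemma (in prob_space) prob_none_le_inverse_expected_count:
  assumes fin: "finite I" and ev: "\<And>i. i \<in> I \<Longrightarrow> A i \<in> events"
    and neg: "\<And>i j. i \<in> I \<Longrightarrow> j \<in> I \<Longrightarrow> i \<noteq> j \<Longrightarrow> prob (A i \<inter> A j) \<le> prob (A i) * prob (A j)"
  shows "prob (space M - (\<Union>i\<in>I. A i)) * (\<Sum>i\<in>I. prob (A i)) \<le> 1"
proof -
  define \<mu> where "\<mu> = (\<Sum>i\<in>I. prob (A i))"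
  define N :: "'a \<Rightarrow> real" where "N x = (\<Sum>i\<in>I. indicator (A i) x)" for x
  let ?Z = "space M - (\<Union>i\<in>I. A i)"
  have Z: "?Z \<in> events" using fin ev by auto
  have int: "integrable M (indicator B :: _ \<Rightarrow> real)" if "B \<in> events" for B
    using that by (simp add: less_top[symmetric])
  have intN: "integrable M N" unfolding N_def using ev int by auto
  have EN: "expectation N = \<mu>"
    unfolding N_def \<mu>_def using ev int sets.sets_into_space
    by (subst Bochner_Integration.integral_sum) (auto intro!: sum.cong simp: Int_absorb2)
  have sq: "N x ^ 2 = (\<Sum>i\<in>I. \<Sum>j\<in>I. indicator (A i \<inter> A j) x)" for x
    by (simp add: N_def power2_eq_square sum_product indicator_inter_arith)
  have intN2: "integrable M (\<lambda>x. N x ^ 2)" unfolding sq using ev int by auto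
  have "expectation (\<lambda>x. N x ^ 2) = (\<Sum>i\<in>I. \<Sum>j\<in>I. prob (A i \<inter> A j))"
  proof -
    have ij: "integrable M (indicator (A i \<inter> A j) :: _ \<Rightarrow> real)"
        "expectation (indicator (A i \<inter> A j)) = prob (A i \<inter> A j)" if "i \<in> I" "j \<in> I" for i j
      using that ev[of i] ev[of j] sets.sets_into_space[of "A i" M] int[of "A i \<inter> A j"]
      by (auto intro!: arg_cong[where f = prob])
    have "expectation (\<lambda>x. N x ^ 2) = (\<Sum>i\<in>I. expectation (\<lambda>x. \<Sum>j\<in>I. indicator (A i \<inter> A j) x))"
      unfolding sq using ij by (intro Bochner_Integration.integral_sum Bochner_Integration.integrable_sum)
    also have "\<dots> = (\<Sum>i\<in>I. \<Sum>j\<in>I. expectation (indicator (A i \<inter> A j)))"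
      using ij by (intro sum.cong refl Bochner_Integration.integral_sum)
    finally show ?thesis using ij by simp
  qed
  also have "\<dots> \<le> (\<Sum>i\<in>I. \<Sum>j\<in>I. (if i = j then prob (A i) else 0) + prob (A i) * prob (A j))"
    using neg by (intro sum_mono) auto
  also have "\<dots> = \<mu> + \<mu> ^ 2"
    using fin by (simp add: sum.distrib \<mu>_def power2_eq_square sum_product)
  finally have EN2: "expectation (\<lambda>x. N x ^ 2) \<le> \<mu> + \<mu> ^ 2" .
  have "\<mu> ^ 2 * prob ?Z = expectation (\<lambda>x. \<mu> ^ 2 * indicator ?Z x)"
    using Z by simp
  also have "\<dots> \<le> expectation (\<lambda>x. N x ^ 2 - 2 * \<mu> * N x + \<mu> ^ 2)"
  proof (rule integral_mono)
    fix x
    have "N x = 0" if "x \<in> ?Z" using that by (simp add: N_def)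
    moreover have "N x ^ 2 - 2 * \<mu> * N x + \<mu> ^ 2 = (N x - \<mu>) ^ 2" by (simp add: power2_diff)
    ultimately show "\<mu> ^ 2 * indicator ?Z x \<le> N x ^ 2 - 2 * \<mu> * N x + \<mu> ^ 2"
      by (cases "x \<in> ?Z") auto
  qed (use intN intN2 int Z in auto)
  also have "\<dots> = expectation (\<lambda>x. N x ^ 2) - \<mu> ^ 2"
    using intN intN2 EN by (simp add: prob_space power2_eq_square)
  finally have "\<mu> * (\<mu> * prob ?Z) \<le> \<mu>" using EN2 by (simp add: power2_eq_square)
  moreover have "\<mu> \<ge> 0" unfolding \<mu>_def by (intro sum_nonneg) auto
  ultimately show ?thesis
    by (cases "\<mu> = 0") (auto simp: \<mu>_def[symmetric] mult.commute)
qed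

text \<open>
  The events of the second moment method are that no record starts with a given word. Distinct words
  of equal length have disjoint cylinders, which makes these events negatively correlated.
\<close>

lemma prob_level_full_le:
  assumes "k > 0"
  shows "records.prob {\<omega>. level_full n k \<omega>} * (2 ^ k * (1 - 1 / 2 ^ k) ^ n) \<le> 1"
proof -
  let ?W = "{w :: bool list. length w = k}"
  define C where "C w = {y. agree w k y}" for w
  define A where "A w = {\<omega> :: nat \<Rightarrow> bitstring. \<forall>i<n. \<omega> i \<in> - C w}" for w
  have C [measurable]: "C w \<in> sets random_bitstring" for w
    unfolding C_def by (rule sets_bitstring_Collect) measurable
  have compl: "- X \<in> sets random_bitstring" if "X \<in> sets random_bitstring" for X
    using sets.compl_sets[OF that] by (simp add: Compl_eq_Diff_UNIV)
  have pcompl: "bits.prob (- X) = 1 - bits.prob X" if "X \<in> sets random_bitstring" for X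
    using bits.prob_compl[OF that] by (simp add: Compl_eq_Diff_UNIV)
  have pC: "bits.prob (C w) = 1 / 2 ^ k" for w
    using prob_agree[of w k] by (simp add: C_def power_one_over)
  have pA: "records.prob (A w) = (1 - 1 / 2 ^ k) ^ n" for w
    unfolding A_def by (subst prob_records_in) (auto simp: compl pcompl pC)
  have evA: "A w \<in> records.events" for w
  proof -
    have [measurable]: "- C w \<in> sets random_bitstring" by (simp add: compl)
    have "Measurable.pred random_records (\<lambda>\<omega>. \<forall>i<n. \<omega> i \<in> - C w)" by measurable
    then show ?thesis unfolding A_def by (rule sets_records_Collect)
  qed
  have neg: "records.prob (A v \<inter> A w) \<le> records.prob (A v) * records.prob (A w)"
    if "v \<in> ?W" "w \<in> ?W" "v \<noteq> w" for v w
  proof -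
    have disj: "C v \<inter> C w = {}"
      using that by (auto simp: C_def agree_def nth_equalityI)
    have "records.prob (A v \<inter> A w) = records.prob {\<omega>. \<forall>i<n. \<omega> i \<in> - (C v \<union> C w)}"
      by (rule arg_cong[where f = records.prob]) (auto simp: A_def)
    also have "\<dots> = (1 - bits.prob (C v \<union> C w)) ^ n"
      using compl[of "C v \<union> C w"] pcompl[of "C v \<union> C w"] by (subst prob_records_in) auto
    also have "bits.prob (C v \<union> C w) = 2 / 2 ^ k"
      using bits.finite_measure_Union[OF C C disj] by (simp add: pC)
    also have "(1 - 2 / 2 ^ k :: real) ^ n \<le> ((1 - 1 / 2 ^ k)\<^sup>2) ^ n"
    proof (rule power_mono)
      show "0 \<le> 1 - 2 / (2 :: real) ^ k"
        using assms power_increasing[of 1 k "2::real"] by simp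
    qed (simp add: power2_diff)
    also have "\<dots> = records.prob (A v) * records.prob (A w)"
      by (simp add: pA power2_eq_square power_mult_distrib)
    finally show ?thesis .
  qed
  \<comment> \<open>A word that no record starts with cannot address a filled node.\<close>
  have "{\<omega>. level_full n k \<omega>} \<subseteq> UNIV - (\<Union>w\<in>?W. A w)"
    using descends_imp_agree[of 0] by (fastforce simp: level_full_iff A_def C_def)
  moreover have "UNIV - (\<Union>w\<in>?W. A w) \<in> records.events"
    using finite_words evA sets.compl_sets[of "\<Union>w\<in>?W. A w" random_records] by auto
  ultimately have "records.prob {\<omega>. level_full n k \<omega>} \<le> records.prob (space random_records - (\<Union>w\<in>?W. A w))"
    by (simp add: records.finite_measure_mono)
  then have "records.prob {\<omega>. level_full n k \<omega>} * (\<Sum>w\<in>?W. records.prob (A w)) \<le>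
      records.prob (space random_records - (\<Union>w\<in>?W. A w)) * (\<Sum>w\<in>?W. records.prob (A w))"
    by (intro mult_right_mono sum_nonneg) auto
  also have "\<dots> \<le> 1"
    using finite_words evA neg by (rule records.prob_none_le_inverse_expected_count)
  finally show ?thesis by (simp add: pA card_words)
qed

section \<open>Two-point concentration\<close>

lemma S_eq_iff:
  assumes "n > 0"
  shows "S n \<omega> = s \<longleftrightarrow> level_full n s \<omega> \<and> \<not> level_full n (Suc s) \<omega>"
proof -
  have "size (random_dst n \<omega>) = n" by (simp add: random_dst_def dst_def size_dst_from)
  then have "random_dst n \<omega> \<noteq> Leaf" using assms by auto
  then show ?thesis by (simp add: S_def level_full_def saturation_level_eq_iff)
qed

lemma prob_two_levels_ge:
  assumes "n > 0"
  shows "records.prob {\<omega>. S n \<omega> = a \<or> S n \<omega> = a + 1} \<ge>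
    1 - records.prob {\<omega>. \<not> level_full n a \<omega>} - records.prob {\<omega>. level_full n (a + 2) \<omega>}"
proof -
  let ?T = "{\<omega>. S n \<omega> = a \<or> S n \<omega> = a + 1}"
  let ?X = "{\<omega>. \<not> level_full n a \<omega>}" and ?Y = "{\<omega>. level_full n (a + 2) \<omega>}"
  have T: "?T \<in> records.events" and X: "?X \<in> records.events" and Y: "?Y \<in> records.events"
    unfolding S_eq_iff[OF assms] by (rule sets_records_Collect, measurable)+
  have "?T \<union> ?X \<union> ?Y = UNIV" using S_eq_iff[OF assms] by auto
  then have "1 = records.prob (?T \<union> ?X \<union> ?Y)" using records.prob_space by simp
  also have "\<dots> \<le> records.prob (?T \<union> ?X) + records.prob ?Y"
    using T X Y by (intro measure_Un_le) auto
  also have "records.prob (?T \<union> ?X) \<le> records.prob ?T + records.prob ?X"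
    using T X by (intro measure_Un_le) auto
  finally show ?thesis by simp
qed

text \<open>
  At the threshold \<open>m = n / ln n\<close> the factor \<open>(1 - 1 / m) ^ n\<close> is about \<open>1 / n\<close>, so a logarithm
  is left to spare; for smaller \<open>m\<close> both factors decrease.
\<close>

lemma union_bound_below_threshold:
  fixes m :: real
  assumes "1 \<le> m" "m \<le> n / ln n" "n > 1"
  shows "4 * m * (1 - 1 / m) ^ n \<le> 4 / ln n"
proof -
  have "ln n \<le> n / m" using assms by (simp add: field_simps)
  have "(1 - 1 / m) ^ n \<le> exp (- (1 / m)) ^ n"
    using assms exp_ge_add_one_self[of "- (1 / m)"] by (intro power_mono) auto
  also have "\<dots> = exp (- (n / m))" by (simp flip: exp_of_nat_mult)
  also have "\<dots> \<le> exp (- ln n)" using \<open>ln n \<le> n / m\<close> by simp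
  also have "\<dots> = 1 / n" using assms by (simp add: exp_minus inverse_eq_divide)
  finally have "4 * m * (1 - 1 / m) ^ n \<le> 4 * (n / ln n) * (1 / n)"
    using assms by (intro mult_mono) auto
  then show ?thesis using assms by simp
qed

text \<open>
  The mean number of coupons out of \<open>m\<close> that are still missing after \<open>n\<close> draws. The argument \<open>m\<close> is real
  because the comparison value \<open>2 * (n / ln n)\<close> need not be an integer.
\<close>

definition expected_missed :: "nat \<Rightarrow> real \<Rightarrow> real" where
  "expected_missed n m = m * (1 - 1 / m) ^ n"

lemma expected_missed_mono:
  assumes "1 \<le> m" "m \<le> m'"
  shows "expected_missed n m \<le> expected_missed n m'"
  unfolding expected_missed_def using assms
  by (intro mult_mono power_mono) (auto simp: field_simps)

theorem theorem6:
  "(\<lambda>n. measure random_records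
          {\<omega> \<in> space random_records. int (S n \<omega>) = k\<^sub>S n - 1 \<or> int (S n \<omega>) = k\<^sub>S n})
     \<longlonglongrightarrow> 1"
proof (rule tendsto_sandwich)
  let ?p = "\<lambda>n. records.prob {\<omega> \<in> space random_records. int (S n \<omega>) = k\<^sub>S n - 1 \<or> int (S n \<omega>) = k\<^sub>S n}"
  let ?g = "\<lambda>n :: nat. expected_missed n (2 * (n / ln n))"
  show "\<forall>\<^sub>F n in sequentially. ?p n \<le> 1" by simp
  show "(\<lambda>n. 1 - 4 / ln (real n) - 1 / ?g n) \<longlonglongrightarrow> 1"
    unfolding expected_missed_def by real_asymp
  show "\<forall>\<^sub>F n in sequentially. 1 - 4 / ln (real n) - 1 / ?g n \<le> ?p n"
  proof -
    have "\<forall>\<^sub>F n in sequentially. log 2 (real n) - log 2 (ln (real n)) > 0"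
      by real_asymp
    moreover have "\<forall>\<^sub>F n in sequentially. 2 * (real n / ln (real n)) > 1"
      by real_asymp
    moreover have "\<forall>\<^sub>F n in sequentially. n > (1 :: nat)" by (rule eventually_gt_at_top)
    ultimately show ?thesis
    proof eventually_elim
      case (elim n)
      define L where "L = log 2 (real n) - log 2 (ln (real n))"
      have "L > 0" using elim(1) by (simp add: L_def)
      then have "\<lceil>L\<rceil> \<ge> 1" by simp
      then obtain a where a: "k\<^sub>S n = int a + 1"
        by (metis L_def k\<^sub>S_def add.commute zle_iff_zadd)
      have La: "real a < L" "L \<le> real a + 1"
        using a ceiling_correct[of L] by (auto simp: k\<^sub>S_def L_def)
      have L: "2 powr L = n / ln n"
        using elim(3) by (simp add: L_def powr_diff)
      have below: "2 ^ a \<le> n / ln n"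
        using powr_mono[of "real a" L 2] La L by (simp add: powr_realpow)
      have "n / ln n \<le> 2 ^ (a + 1)"
      proof -
        have "2 powr L \<le> 2 powr real (a + 1)" using La by (intro powr_mono) auto
        also have "\<dots> = 2 ^ (a + 1)" by (rule powr_realpow) simp
        finally show ?thesis using L by simp
      qed
      then have above: "2 * (n / ln n) \<le> 2 ^ (a + 2)" by simp
      have "records.prob {\<omega>. \<not> level_full n a \<omega>} \<le> 4 / ln n"
        using prob_not_level_full_le[of n a] union_bound_below_threshold[OF _ below elim(3)] by simp
      moreover have "records.prob {\<omega>. level_full n (a + 2) \<omega>} \<le> 1 / ?g n"
      proof -
        have g: "?g n > 0" using elim(2,3) by (simp add: expected_missed_def)
        have "records.prob {\<omega>. level_full n (a + 2) \<omega>} * ?g n \<le>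
            records.prob {\<omega>. level_full n (a + 2) \<omega>} * expected_missed n (2 ^ (a + 2))"
          using elim(2) above by (intro mult_left_mono expected_missed_mono) auto
        also have "\<dots> \<le> 1" using prob_level_full_le[of "a + 2" n] by (simp add: expected_missed_def)
        finally show ?thesis using g by (simp add: field_simps)
      qed
      moreover have "?p n = records.prob {\<omega>. S n \<omega> = a \<or> S n \<omega> = a + 1}"
        by (rule arg_cong[where f = records.prob]) (auto simp: a)
      ultimately show ?case using prob_two_levels_ge[of n a] elim(3) by simp
    qed
  qed
qed simp

end
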